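(* Let $N=\begin{pmatrix}p&r\\0&q\end{pmatrix}\in UT_2(\mathbb{Z})$. Suppose that one of the following holds: (1) $p$ and $q$ are odd, and either ($p\equiv q\pmod 4$ and $r\equiv 0\pmod 2$), or ($p\not\equiv q\pmod 4$ and $r$ is arbitrary); (2) one of $p,q$ is odd and the other is divisible by $4$, and $r$ is arbitrary; (3) $p\equiv q\equiv 0\pmod 4$, and: if $(p,q)\bmod 16\in\{(4,4),(12,12)\}$ then $r\equiv 0\pmod 4$; if $(p,q)\bmod 16\in\{(4,12),(8,8),(12,4)\}$ then $r\equiv 0\pmod 2$; otherwise $r$ is arbitrary. Then there exist infinitely many Jordan $D(N)$-quadruples in $UT_2(\mathbb{Z})$.
   Context: $UT_2(\mathbb{Z})$ denotes the ring of upper-triangular $2\times 2$ integer matrices, and $A\circ B=\frac12(AB+BA)$ (computed over $\mathbb{Q}$) is the Jordan product. For $N\in UT_2(\mathbb{Z})$, a Jordan $D(N)$-quadruple in $UT_2(\mathbb{Z})$ is a set of four distinct nonzero matrices $A_1,A_2,A_3,A_4\in UT_2(\mathbb{Z})$ such that for every $1\le i<j\le 4$ there exists $X_{ij}\in UT_2(\mathbb{Z})$ with $A_i\circ A_j+N=X_{ij}^2$. *)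

theory Defs
  imports "HOL-Analysis.Analysis"
begin

definition UT2 :: "(int^2^2) set" where
  "UT2 = {A. A $ 2 $ 1 = 0}"

definition rat_mat :: "int^2^2 \<Rightarrow> rat^2^2" where
  "rat_mat A = map_matrix rat_of_int A"

definition jordan_prod :: "rat^2^2 \<Rightarrow> rat^2^2 \<Rightarrow> rat^2^2" (infixl "\<circ>\<^sub>J" 70) where
  "A \<circ>\<^sub>J B = map_matrix (\<lambda>x. 1/2 * x) (A ** B + B ** A)"

(* The square is written X ** X, since ( * ) and ( ^ ) on the type int^2^2 act componentwise. *)
definition jordan_D_quadruple :: "int^2^2 \<Rightarrow> (int^2^2) set \<Rightarrow> bool" where
  "jordan_D_quadruple N Q \<longleftrightarrow>
     Q \<subseteq> UT2 - {0} \<and> card Q = 4 \<and>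
     (\<forall>A\<in>Q. \<forall>B\<in>Q. A \<noteq> B \<longrightarrow>
        (\<exists>X\<in>UT2. rat_mat A \<circ>\<^sub>J rat_mat B + rat_mat N = rat_mat (X ** X)))"

end

theory Submission
  imports Defs
begin

text \<open>
  Write an upper triangular matrix as a triple \<open>(a, b, c)\<close>, with diagonal entries \<open>a\<close>, \<open>c\<close> and
  corner \<open>b\<close>. The entries of the Jordan product of \<open>(a, b, c)\<close> and \<open>(a', b', c')\<close> are \<open>a a'\<close>,
  \<open>c c'\<close> and \<open>((a + c) b' + (a' + c') b) / 2\<close>, while \<open>(x, y, z)\<close> has the square
  \<open>(x\<^sup>2, y (x + z), z\<^sup>2)\<close>. So the diagonals must solve the classical problem for \<open>p\<close> and for
  \<open>q\<close>, and what remains are linear congruences modulo \<open>x + z\<close> for the corners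
  (\<open>linked_tri_iff\<close>).

  The diagonal entries of the four matrices may coincide, so let all four have the same diagonal
  \<open>(a, c)\<close>, where \<open>a\<^sup>2 + p = x\<^sup>2\<close> and \<open>c\<^sup>2 + q = z\<^sup>2\<close>. If \<open>x + z \<noteq> 0\<close> and the gcd of
  \<open>a + c\<close> and \<open>x + z\<close> divides \<open>r\<close>, all the congruences hold as soon as the corners lie in a
  suitable residue class modulo \<open>2 (x + z)\<close>, so that there are infinitely many quadruples
  (\<open>infinite_quadruples_if_constant_diagonal\<close>). An odd \<open>p\<close> or a multiple of \<open>4\<close> is a difference
  \<open>x\<^sup>2 - a\<^sup>2\<close>:
  \<open>2 P + 1 = (P + 1)\<^sup>2 - P\<^sup>2\<close> and \<open>4 k = (k + 1)\<^sup>2 - (k - 1)\<^sup>2\<close>, and also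
  \<open>16 m = (2 (m + 1))\<^sup>2 - (2 (m - 1))\<^sup>2\<close>.
  The signs of \<open>c\<close> and \<open>z\<close> are free, and they can be chosen so that \<open>x + z\<close> and \<open>a + c\<close>
  differ by \<open>\<plusminus>1\<close>, \<open>2\<close> or \<open>4\<close>, or that \<open>a + c\<close> is itself a small constant. The conditions
  imposed on \<open>r\<close> are exactly what makes the resulting gcd divide \<open>r\<close>.

  These choices fail, with \<open>x = z = 0\<close>, only if the diagonal of \<open>N\<close> is \<open>(-1, -1)\<close>,
  \<open>(-4, -4)\<close>, \<open>(-1, -4)\<close> or \<open>(-4, -1)\<close>. There the classical \<open>D(-1)\<close>-triple
  \<open>{1, 2, 5}\<close> and its double \<open>{2, 4, 10}\<close>, placed on the two diagonals up to sign and with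
  repetitions at different positions, give explicit one-parameter families. Reflection in the antidiagonal
  exchanges \<open>p\<close> and \<open>q\<close> and halves the number of cases.
\<close>

section \<open>Upper triangular matrices as triples\<close>

definition tri :: "int \<Rightarrow> int \<Rightarrow> int \<Rightarrow> int^2^2" where
  "tri a b c = vector [vector [a, b], vector [0, c]]"

lemma tri_eq_iff [simp]: "tri a b c = tri a' b' c' \<longleftrightarrow> a = a' \<and> b = b' \<and> c = c'"
  by (auto simp: tri_def vec_eq_iff forall_2)

lemma tri_eq_0_iff [simp]: "tri a b c = 0 \<longleftrightarrow> a = 0 \<and> b = 0 \<and> c = 0"
  by (auto simp: tri_def vec_eq_iff forall_2)

lemma tri_in_UT2 [simp]: "tri a b c \<in> UT2"
  by (simp add: tri_def UT2_def)

lemma UT2_E: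
  assumes "A \<in> UT2"
  obtains a b c where "A = tri a b c"
proof
  show "A = tri (A $ 1 $ 1) (A $ 1 $ 2) (A $ 2 $ 2)"
    using assms by (simp add: tri_def UT2_def vec_eq_iff forall_2)
qed

definition linked :: "int^2^2 \<Rightarrow> int^2^2 \<Rightarrow> int^2^2 \<Rightarrow> bool" where
  "linked N A B \<longleftrightarrow> (\<exists>X\<in>UT2. rat_mat A \<circ>\<^sub>J rat_mat B + rat_mat N = rat_mat (X ** X))"

lemma jordan_eq_square_iff:
  "rat_mat (tri a b c) \<circ>\<^sub>J rat_mat (tri a' b' c') + rat_mat (tri p r q)
     = rat_mat (tri x y z ** tri x y z)
   \<longleftrightarrow> a * a' + p = x\<^sup>2 \<and> c * c' + q = z\<^sup>2 \<and>
       (a + c) * b' + (a' + c') * b + 2 * r = 2 * y * (x + z)" (is "?L \<longleftrightarrow> ?R")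
proof -
  have "?L \<longleftrightarrow> rat_of_int (a * a' + p) = rat_of_int (x\<^sup>2) \<and>
    rat_of_int (c * c' + q) = rat_of_int (z\<^sup>2) \<and>
    rat_of_int ((a + c) * b' + (a' + c') * b + 2 * r) = rat_of_int (2 * y * (x + z))"
    by (auto simp: tri_def rat_mat_def jordan_prod_def map_matrix_def vec_eq_iff forall_2
        matrix_matrix_mult_def sum_2 power2_eq_square field_simps)
  also have "\<dots> \<longleftrightarrow> ?R"
    by (simp only: of_int_eq_iff)
  finally show ?thesis .
qed

text \<open>
  The signs of \<open>x\<close> and \<open>z\<close> are free here. Only their relative sign matters, and it decides
  whether the corner condition is a congruence modulo the sum or the difference of the two roots.
\<close>

lemma linked_tri_iff:
  "linked (tri p r q) (tri a b c) (tri a' b' c') \<longleftrightarrow>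
    (\<exists>x y z. a * a' + p = x\<^sup>2 \<and> c * c' + q = z\<^sup>2 \<and>
       (a + c) * b' + (a' + c') * b + 2 * r = 2 * y * (x + z))"
  unfolding linked_def by (metis UT2_E tri_in_UT2 jordan_eq_square_iff)

lemma linked_triI:
  assumes "a * a' + p = x\<^sup>2" "c * c' + q = z\<^sup>2"
    and "(a + c) * b' + (a' + c') * b + 2 * r = 2 * y * (x + z)"
  shows "linked (tri p r q) (tri a b c) (tri a' b' c')"
  using assms linked_tri_iff by blast

lemma linked_commute: "linked N A B \<longleftrightarrow> linked N B A"
  by (simp add: linked_def jordan_prod_def add.commute)

lemma jordan_D_quadruple_iff_linked:
  "jordan_D_quadruple N Q \<longleftrightarrow>
     Q \<subseteq> UT2 - {0} \<and> card Q = 4 \<and> (\<forall>A\<in>Q. \<forall>B\<in>Q. A \<noteq> B \<longrightarrow> linked N A B)"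
  by (simp add: jordan_D_quadruple_def linked_def)

section \<open>Reflection in the antidiagonal\<close>

text \<open>
  On upper triangular matrices this is transposition followed by conjugation by the
  antidiagonal permutation matrix. It reverses products, so it respects the symmetric Jordan
  product and squares.
\<close>

definition reflect :: "int^2^2 \<Rightarrow> int^2^2" where
  "reflect A = tri (A $ 2 $ 2) (A $ 1 $ 2) (A $ 1 $ 1)"

lemma reflect_tri [simp]: "reflect (tri a b c) = tri c b a"
  by (simp add: reflect_def tri_def)

lemma inj_on_reflect: "inj_on reflect UT2"
  by (auto intro!: inj_onI elim!: UT2_E)

lemma linked_reflect:
  "linked (tri q r p) (tri c b a) (tri c' b' a') \<longleftrightarrow> linked (tri p r q) (tri a b c) (tri a' b' c')"
  unfolding linked_tri_iff by (metis add.commute)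

lemma jordan_D_quadruple_reflect:
  assumes "jordan_D_quadruple (tri p r q) Q"
  shows "jordan_D_quadruple (tri q r p) (reflect ` Q)"
proof -
  have UT: "Q \<subseteq> UT2" and nz: "0 \<notin> Q" and card: "card Q = 4"
    and lk: "\<And>A B. A \<in> Q \<Longrightarrow> B \<in> Q \<Longrightarrow> A \<noteq> B \<Longrightarrow> linked (tri p r q) A B"
    using assms by (auto simp: jordan_D_quadruple_iff_linked)
  have "card (reflect ` Q) = 4"
    using card_image[OF inj_on_subset[OF inj_on_reflect UT]] card by simp
  moreover have "reflect A \<in> UT2 - {0}" if A: "A \<in> Q" for A
  proof -
    obtain a b c where "A = tri a b c" using UT A by (blast elim: UT2_E)
    then show ?thesis using A nz by (metis DiffI reflect_tri singletonD tri_eq_0_iff tri_in_UT2)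
  qed
  moreover have "linked (tri q r p) (reflect A) (reflect B)"
    if A: "A \<in> Q" "B \<in> Q" "reflect A \<noteq> reflect B" for A B
  proof -
    obtain a b c where "A = tri a b c" using UT A by (blast elim: UT2_E)
    moreover obtain a' b' c' where "B = tri a' b' c'" using UT A by (blast elim: UT2_E)
    ultimately show ?thesis using lk[of A B] A by (auto simp: linked_reflect)
  qed
  ultimately show ?thesis
    unfolding jordan_D_quadruple_iff_linked by auto
qed

lemma infinite_quadruples_reflect:
  assumes "infinite {Q. jordan_D_quadruple (tri p r q) Q}"
  shows "infinite {Q. jordan_D_quadruple (tri q r p) Q}"
proof -
  have "inj_on ((`) reflect) {Q. jordan_D_quadruple (tri p r q) Q}"
    by (rule inj_on_subset[OF inj_on_image_Pow[OF inj_on_reflect]])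
       (auto simp: jordan_D_quadruple_def)
  then have "infinite ((`) reflect ` {Q. jordan_D_quadruple (tri p r q) Q})"
    using assms by (simp add: finite_image_iff)
  then show ?thesis
    by (rule infinite_super[rotated]) (auto intro: jordan_D_quadruple_reflect)
qed

section \<open>Infinitely many quadruples from infinitely many entries\<close>

text \<open>
  A quadruple is a finite set, so finitely many of them involve only finitely many matrices. This
  replaces an enumeration of pairwise different quadruples.
\<close>

lemma infinite_quadruples_if_infinite_Union:
  assumes "infinite (\<Union>{Q. jordan_D_quadruple N Q})"
  shows "infinite {Q. jordan_D_quadruple N Q}"
proof
  assume "finite {Q. jordan_D_quadruple N Q}"
  then have "finite (\<Union>{Q. jordan_D_quadruple N Q})"
    by (rule finite_Union) (auto simp: jordan_D_quadruple_def intro: card_ge_0_finite)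
  with assms show False ..
qed

lemma infinite_quadruples_if_infinite_clique:
  assumes inf: "infinite S" and UT: "S \<subseteq> UT2"
    and lk: "\<And>A B. A \<in> S \<Longrightarrow> B \<in> S \<Longrightarrow> linked N A B"
  shows "infinite {Q. jordan_D_quadruple N Q}"
proof (rule infinite_quadruples_if_infinite_Union)
  have inf0: "infinite (S - {0})" using inf by simp
  \<comment> \<open>Every nonzero matrix of the clique lies in some quadruple.\<close>
  have "A \<in> \<Union>{Q. jordan_D_quadruple N Q}" if A: "A \<in> S - {0}" for A
  proof -
    have "infinite (S - {0} - {A})" using inf0 by simp
    then obtain B where B: "B \<subseteq> S - {0} - {A}" "finite B" "card B = 3"
      by (meson infinite_arbitrarily_large)
    then have "card (insert A B) = 4" by (auto simp: card_insert_if)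
    then have "jordan_D_quadruple N (insert A B)"
      using A B(1) UT lk unfolding jordan_D_quadruple_iff_linked by blast
    then show ?thesis by blast
  qed
  then show "infinite (\<Union>{Q. jordan_D_quadruple N Q})"
    using inf0 by (meson infinite_super subsetI)
qed

lemma infinite_quadruples_if_family:
  fixes A :: "int \<Rightarrow> int^2^2"
  assumes inj: "inj A" and UT: "\<And>t. {A t, B, C, D} \<subseteq> UT2 - {0}"
    and ne: "\<And>t. distinct [A t, B, C, D]"
    and lk: "\<And>t. linked N (A t) B" "\<And>t. linked N (A t) C" "\<And>t. linked N (A t) D"
      "linked N B C" "linked N B D" "linked N C D"
  shows "infinite {Q. jordan_D_quadruple N Q}"
proof (rule infinite_quadruples_if_infinite_Union)
  have "jordan_D_quadruple N {A t, B, C, D}" for t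
  proof -
    have "card {A t, B, C, D} = 4" using ne[of t] by simp
    then show ?thesis
      using UT[of t] lk lk[THEN iffD1[OF linked_commute]]
      unfolding jordan_D_quadruple_iff_linked by auto
  qed
  then have "range A \<subseteq> \<Union>{Q. jordan_D_quadruple N Q}" by blast
  moreover have "infinite (range A)"
    using inj by (simp add: finite_image_iff infinite_UNIV_int)
  ultimately show "infinite (\<Union>{Q. jordan_D_quadruple N Q})"
    by (rule infinite_super)
qed

section \<open>Quadruples with a constant diagonal\<close>

text \<open>
  Bezout's identity gives a corner \<open>\<beta>\<close> with \<open>(a + c) \<beta> + r \<equiv> 0\<close> modulo \<open>x + z\<close>. Since the
  condition on a pair is \<open>(a + c) (b + b') / 2 + r \<equiv> 0\<close>, it then holds for all corners \<open>b\<close>, \<open>b'\<close>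
  congruent to \<open>\<beta>\<close> modulo \<open>2 (x + z)\<close>; the factor \<open>2\<close> absorbs the denominator.
\<close>

lemma infinite_quadruples_if_constant_diagonal:
  assumes sq: "a\<^sup>2 + p = x\<^sup>2" "c\<^sup>2 + q = z\<^sup>2"
    and w: "x + z \<noteq> 0" and g: "gcd (a + c) (x + z) dvd r"
  shows "infinite {Q. jordan_D_quadruple (tri p r q) Q}"
proof -
  obtain \<beta> \<gamma> where bez: "(a + c) * \<beta> + r = (x + z) * \<gamma>"
  proof -
    obtain u v where uv: "u * (a + c) + v * (x + z) = gcd (a + c) (x + z)"
      using bezout_int by blast
    obtain k where "r = gcd (a + c) (x + z) * k" using g by blast
    then have "(a + c) * (- u * k) + r = (x + z) * (v * k)"
      unfolding uv[symmetric] by (simp add: algebra_simps)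
    then show thesis by (rule that)
  qed
  define A where "A t = tri a (\<beta> + 2 * (x + z) * t) c" for t
  show ?thesis
  proof (rule infinite_quadruples_if_infinite_clique)
    have "inj A" using w by (auto simp: A_def intro!: injI)
    then show "infinite (range A)" by (simp add: finite_image_iff infinite_UNIV_int)
    show "range A \<subseteq> UT2" by (auto simp: A_def)
    have "linked (tri p r q) (A t) (A t')" for t t'
      unfolding A_def
    proof (rule linked_triI)
      show "a * a + p = x\<^sup>2" "c * c + q = z\<^sup>2" using sq by (simp_all add: power2_eq_square)
      have "(a + c) * (\<beta> + 2 * (x + z) * t') + (a + c) * (\<beta> + 2 * (x + z) * t) + 2 * r
          = 2 * ((a + c) * \<beta> + r) + 2 * (a + c) * (t + t') * (x + z)"
        by (simp add: algebra_simps)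
      also have "\<dots> = 2 * (\<gamma> + (a + c) * (t + t')) * (x + z)"
        unfolding bez by (simp add: algebra_simps)
      finally show "(a + c) * (\<beta> + 2 * (x + z) * t') + (a + c) * (\<beta> + 2 * (x + z) * t) + 2 * r
          = 2 * (\<gamma> + (a + c) * (t + t')) * (x + z)" .
    qed
    then show "linked (tri p r q) M M'" if "M \<in> range A" "M' \<in> range A" for M M'
      using that by blast
  qed
qed

section \<open>The exceptional diagonals\<close>

text \<open>
  Both diagonals come from the \<open>D(-1)\<close>-triple \<open>{1, 2, 5}\<close>, with \<open>1\<close> repeated: since
  \<open>1 \<cdot> 1 - 1 = 0\<close> while the other products give roots \<open>1\<close>, \<open>2\<close>, \<open>3\<close>, repeating it at different
  positions keeps the two roots of a pair from vanishing together. The roots of most pairs then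
  have sum or difference \<open>1\<close> up to sign, and the few congruences left are solved by corners
  linear in \<open>u\<close> and the free parameter \<open>t\<close>.
\<close>

lemma links_neg1_neg1:
  fixes u t :: int
  defines "N \<equiv> tri (- 1) (2 * u) (- 1)"
  shows "linked N (tri 2 (4 * t) 1) (tri 1 0 1)"
    and "linked N (tri 2 (4 * t) 1) (tri 1 0 2)"
    and "linked N (tri 2 (4 * t) 1) (tri 5 (- 2 * u) 5)"
    and "linked N (tri 1 0 1) (tri 1 0 2)"
    and "linked N (tri 1 0 1) (tri 5 (- 2 * u) 5)"
    and "linked N (tri 1 0 2) (tri 5 (- 2 * u) 5)"
proof -
  show "linked N (tri 2 (4 * t) 1) (tri 1 0 1)" unfolding N_def
    by (rule linked_triI[where x = 1 and z = 0 and y = "4 * t + 2 * u"]) auto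
  show "linked N (tri 2 (4 * t) 1) (tri 1 0 2)" unfolding N_def
    by (rule linked_triI[where x = 1 and z = 1 and y = "3 * t + u"]) auto
  show "linked N (tri 2 (4 * t) 1) (tri 5 (- 2 * u) 5)" unfolding N_def
    by (rule linked_triI[where x = 3 and z = "- 2" and y = "20 * t - u"]) auto
  show "linked N (tri 1 0 1) (tri 1 0 2)" unfolding N_def
    by (rule linked_triI[where x = 0 and z = 1 and y = "2 * u"]) auto
  show "linked N (tri 1 0 1) (tri 5 (- 2 * u) 5)" unfolding N_def
    by (rule linked_triI[where x = 2 and z = 2 and y = 0]) auto
  show "linked N (tri 1 0 2) (tri 5 (- 2 * u) 5)" unfolding N_def
    by (rule linked_triI[where x = "- 2" and z = 3 and y = "- u"]) auto
qed

text \<open>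
  Doubling both diagonals and both roots, with all corners kept, multiplies the corner condition
  by \<open>2\<close>. This carries the family for \<open>(-1, -1)\<close> with even \<open>r\<close> to one for \<open>(-4, -4)\<close> with \<open>r\<close>
  divisible by \<open>4\<close>, exactly the case that is needed.
\<close>

lemma linked_double:
  assumes "linked (tri p r q) (tri a b c) (tri a' b' c')"
  shows "linked (tri (4 * p) (2 * r) (4 * q)) (tri (2 * a) b (2 * c)) (tri (2 * a') b' (2 * c'))"
proof -
  obtain x y z where "a * a' + p = x\<^sup>2" "c * c' + q = z\<^sup>2"
    and "(a + c) * b' + (a' + c') * b + 2 * r = 2 * y * (x + z)"
    using assms unfolding linked_tri_iff by blast
  then show ?thesis
    by (intro linked_triI[where x = "2 * x" and z = "2 * z" and y = y])
       (simp_all add: algebra_simps power2_eq_square)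
qed

lemma infinite_quadruples_neg1_neg1:
  assumes "even r"
  shows "infinite {Q. jordan_D_quadruple (tri (- 1) r (- 1)) Q}"
proof -
  obtain u where r: "r = 2 * u" using assms by blast
  show ?thesis unfolding r
    by (rule infinite_quadruples_if_family[OF _ _ _ links_neg1_neg1]) (auto intro: injI)
qed

lemma infinite_quadruples_neg4_neg4:
  assumes "4 dvd r"
  shows "infinite {Q. jordan_D_quadruple (tri (- 4) r (- 4)) Q}"
proof -
  obtain u where r: "r = 4 * u" using assms by blast
  show ?thesis unfolding r
    by (rule infinite_quadruples_if_family[OF _ _ _ links_neg1_neg1[THEN linked_double, simplified]])
       (auto intro: injI)
qed

text \<open>
  Now \<open>{1, 2, 5}\<close> is combined with the \<open>D(-4)\<close>-triple \<open>{2, 4, 10}\<close>, again with different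
  repetitions. The second diagonal is negated, so that the matrix with diagonal \<open>(2, -2)\<close> has
  trace \<open>0\<close> and its congruences become simple; all of them are solved by corners linear in \<open>r\<close> and
  the free parameter.
\<close>

lemma infinite_quadruples_neg1_neg4:
  "infinite {Q. jordan_D_quadruple (tri (- 1) r (- 4)) Q}"
proof (rule infinite_quadruples_if_family)
  let ?N = "tri (- 1) r (- 4)" and ?A = "\<lambda>t. tri 1 (8 * t - 3 * r) (- 4)"
    and ?B = "tri 1 (- r) (- 2)" and ?C = "tri 2 (- 2 * r) (- 2)" and ?D = "tri 5 (3 * r) (- 10)"
  show "inj ?A" by (auto intro: injI)
  show "{?A t, ?B, ?C, ?D} \<subseteq> UT2 - {0}" for t by auto
  show "distinct [?A t, ?B, ?C, ?D]" for t by auto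
  show "linked ?N (?A t) ?B" for t
    by (rule linked_triI[where x = 0 and z = 2 and y = "2 * r - 2 * t"]) auto
  show "linked ?N (?A t) ?C" for t
    by (rule linked_triI[where x = "- 1" and z = 2 and y = "4 * r"]) auto
  show "linked ?N (?A t) ?D" for t
    by (rule linked_triI[where x = "- 2" and z = 6 and y = "r - 5 * t"]) auto
  show "linked ?N ?B ?C"
    by (rule linked_triI[where x = 1 and z = 0 and y = "2 * r"]) auto
  show "linked ?N ?B ?D"
    by (rule linked_triI[where x = "- 2" and z = 4 and y = r]) auto
  show "linked ?N ?C ?D"
    by (rule linked_triI[where x = "- 3" and z = 4 and y = "6 * r"]) auto
qed

section \<open>Choice of the constant diagonal\<close>

text \<open>
  The bounds on the gcd of \<open>a + c\<close> and \<open>x + z\<close> all come from their difference \<open>d\<close>.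
\<close>

lemma gcd_shift_dvd:
  fixes s d w r :: int
  assumes "gcd s d dvd r" and "w = s + d"
  shows "gcd s w dvd r"
  using assms by simp

lemma gcd_2_dvd:
  fixes s r :: int
  assumes "odd s \<or> even r"
  shows "gcd s 2 dvd r"
proof (cases "odd s")
  case True
  then have "gcd s 2 = 1" by simp
  then show ?thesis by simp
next
  case False
  with assms show ?thesis by simp
qed

lemma gcd_4_dvd:
  fixes s r :: int
  assumes "odd s \<or> (\<not> 4 dvd s \<and> even r) \<or> 4 dvd r"
  shows "gcd s 4 dvd r"
proof -
  consider "odd s" | "even s" "\<not> 4 dvd s" "even r" | "4 dvd r" using assms by blast
  then show ?thesis
  proof cases
    case 1
    then have "coprime s (2 ^ 2)" by (intro coprime_power_right_iff[THEN iffD2] disjI1) simp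
    then have "gcd s 4 = 1" by simp
    then show ?thesis by simp
  next
    case 2
    then obtain k where k: "s = 2 * k" by blast
    then have "odd k" using 2 by auto
    then have "gcd s 4 = 2 * gcd k 2" using gcd_mult_distrib_int[of 2 k 2] k by simp
    also have "gcd k 2 = 1" using \<open>odd k\<close> by simp
    finally show ?thesis using 2 by simp
  qed (meson dvd_trans gcd_dvd2)
qed

text \<open>
  With equal signs the difference of \<open>x + z\<close> and \<open>a + c\<close> is \<open>2\<close>, and \<open>a + c = P + Q\<close> is odd if and
  only if \<open>p\<close> and \<open>q\<close> differ modulo \<open>4\<close>. If \<open>x + z\<close> vanishes, then \<open>a + c = -2\<close>, and changing the
  sign of \<open>z\<close> alone repairs this unless \<open>p = q = -1\<close>.
\<close>

lemma infinite_quadruples_odd_odd: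
  assumes "odd p" "odd q" "even r \<or> p mod 4 \<noteq> q mod 4"
  shows "infinite {Q. jordan_D_quadruple (tri p r q) Q}"
proof -
  obtain P Q where p: "p = 2 * P + 1" and q: "q = 2 * Q + 1"
    using assms by (meson oddE)
  have par: "odd (P + Q) \<or> even r" using assms(3) unfolding p q by presburger
  consider "P + Q \<noteq> - 2" | "P + Q = - 2" "P \<noteq> - 1" | "P = - 1" "Q = - 1" by linarith
  then show ?thesis
  proof cases
    case 1
    have "gcd (P + Q) (P + 1 + (Q + 1)) dvd r"
      by (rule gcd_shift_dvd[OF gcd_2_dvd[OF par]]) simp
    with 1 show ?thesis
      by (intro infinite_quadruples_if_constant_diagonal[of P p "P + 1" Q q "Q + 1"])
         (auto simp: p q power2_eq_square algebra_simps)
  next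
    case 2
    then have Q: "Q = - 2 - P" and "even r" using par by auto
    then have "P + Q dvd r" by simp
    then have "gcd (P + Q) (P + 1 + - (Q + 1)) dvd r"
      using gcd_dvd1 dvd_trans by blast
    with 2 show ?thesis
      by (intro infinite_quadruples_if_constant_diagonal[of P p "P + 1" Q q "- (Q + 1)"])
         (auto simp: p q power2_eq_square algebra_simps)
  next
    case 3
    then show ?thesis using infinite_quadruples_neg1_neg1 par p q by simp
  qed
qed

text \<open>
  Equal signs would leave the difference \<open>3\<close>, and \<open>3\<close> need not divide \<open>r\<close>. With \<open>c\<close> and \<open>z\<close> negated
  the difference becomes \<open>-1\<close>. The root sum \<open>P - k\<close> vanishes if \<open>P = k\<close>, but then \<open>a + c = 1\<close>, so
  that \<open>z\<close> may take the other sign.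
\<close>

lemma infinite_quadruples_odd_dvd_4:
  assumes "odd p" "4 dvd q"
  shows "infinite {Q. jordan_D_quadruple (tri p r q) Q}"
proof -
  obtain P k where p: "p = 2 * P + 1" and q: "q = 4 * k"
    using assms by (meson oddE dvdE)
  consider "P \<noteq> k" | "P = k" "k \<noteq> - 1" | "P = - 1" "k = - 1" by linarith
  then show ?thesis
  proof cases
    case 1
    have "gcd (P + (1 - k)) (P + 1 + - (k + 1)) dvd r"
      by (rule gcd_shift_dvd[of _ "- 1"]) auto
    with 1 show ?thesis
      by (intro infinite_quadruples_if_constant_diagonal[of P p "P + 1" "1 - k" q "- (k + 1)"])
         (auto simp: p q power2_eq_square algebra_simps)
  next
    case 2
    then show ?thesis
      by (intro infinite_quadruples_if_constant_diagonal[of P p "P + 1" "1 - k" q "k + 1"])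
         (auto simp: p q power2_eq_square algebra_simps)
  next
    case 3
    then show ?thesis using infinite_quadruples_neg1_neg4[of r] p q by simp
  qed
qed

text \<open>
  Here the representations of \<open>p\<close> and \<open>q\<close> that work for all multiples of \<open>4\<close> would leave an even
  gcd, although \<open>r\<close> may be odd. Writing \<open>16 m\<close> as a difference of two even squares and \<open>8 h\<close> as a
  difference of two odd ones makes \<open>a + c\<close> odd; with \<open>c\<close> and \<open>z\<close> negated the difference is \<open>2\<close>, so
  the gcd is \<open>1\<close>.
\<close>

lemma infinite_quadruples_dvd_16_dvd_8:
  assumes "16 dvd p" "8 dvd q"
  shows "infinite {Q. jordan_D_quadruple (tri p r q) Q}"
proof -
  obtain m h where p: "p = 16 * m" and q: "q = 8 * h" using assms by (meson dvdE)
  let ?s = "2 * (m - 1) + (1 - 2 * h)"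
  have "odd ?s \<or> even r" by simp
  then have "gcd ?s (2 * (m + 1) + - (2 * h + 1)) dvd r"
    by (rule gcd_shift_dvd[OF gcd_2_dvd]) simp
  moreover have "2 * (m + 1) + - (2 * h + 1) \<noteq> 0" by presburger
  ultimately show ?thesis
    by (intro infinite_quadruples_if_constant_diagonal
          [of "2 * (m - 1)" p "2 * (m + 1)" "1 - 2 * h" q "- (2 * h + 1)"])
       (auto simp: p q power2_eq_square algebra_simps)
qed

text \<open>
  With equal signs \<open>x + z = k + l + 2\<close> and \<open>a + c = k + l - 2\<close> differ by \<open>4\<close>. If the former
  vanishes, the latter is \<open>-4\<close>, and the sign of \<open>z\<close> can be changed unless \<open>k = l = -1\<close>.
\<close>

lemma infinite_quadruples_dvd_4_dvd_4:
  assumes "odd (k + l) \<or> (4 dvd k + l \<and> even r) \<or> 4 dvd r"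
    and "k + l = - 2 \<Longrightarrow> 4 dvd r"
  shows "infinite {Q. jordan_D_quadruple (tri (4 * k) r (4 * l)) Q}"
proof -
  consider "k + l \<noteq> - 2" | "k + l = - 2" "k \<noteq> - 1" | "k = - 1" "l = - 1" by linarith
  then show ?thesis
  proof cases
    case 1
    let ?s = "k - 1 + (l - 1)"
    have "odd ?s \<or> (\<not> 4 dvd ?s \<and> even r) \<or> 4 dvd r" using assms(1) by presburger
    then have "gcd ?s (k + 1 + (l + 1)) dvd r"
      by (rule gcd_shift_dvd[OF gcd_4_dvd]) simp
    with 1 show ?thesis
      by (intro infinite_quadruples_if_constant_diagonal
            [of "k - 1" "4 * k" "k + 1" "l - 1" "4 * l" "l + 1"])
         (auto simp: power2_eq_square algebra_simps)
  next
    case 2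
    then have l: "l = - 2 - k" and "4 dvd r" using assms(2) by auto
    then have "k - 1 + (l - 1) dvd r" by simp
    then have "gcd (k - 1 + (l - 1)) (k + 1 + - (l + 1)) dvd r"
      using gcd_dvd1 dvd_trans by blast
    with 2 show ?thesis
      by (intro infinite_quadruples_if_constant_diagonal
            [of "k - 1" "4 * k" "k + 1" "l - 1" "4 * l" "- (l + 1)"])
         (auto simp: power2_eq_square algebra_simps)
  next
    case 3
    then show ?thesis using infinite_quadruples_neg4_neg4 assms(2) by simp
  qed
qed

theorem corollary6:
  fixes p q r :: int and N :: "int^2^2"
  assumes N: "N = vector [vector [p, r], vector [0, q]]"
    and cases:
      "(odd p \<and> odd q \<and> ((p mod 4 = q mod 4 \<and> even r) \<or> p mod 4 \<noteq> q mod 4))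
       \<or> ((odd p \<and> 4 dvd q) \<or> (odd q \<and> 4 dvd p))
       \<or> (4 dvd p \<and> 4 dvd q \<and>
           ((p mod 16, q mod 16) \<in> {(4, 4), (12, 12)} \<longrightarrow> 4 dvd r) \<and>
           ((p mod 16, q mod 16) \<in> {(4, 12), (8, 8), (12, 4)} \<longrightarrow> 2 dvd r))"
  shows "infinite {Q. jordan_D_quadruple N Q}"
proof -
  have N: "N = tri p r q" using N by (simp add: tri_def)
  consider (odd_odd) "odd p" "odd q" "even r \<or> p mod 4 \<noteq> q mod 4"
    | (odd_even) "odd p" "4 dvd q" | (even_odd) "odd q" "4 dvd p"
    | (even_even) "4 dvd p" "4 dvd q"
        "(p mod 16, q mod 16) \<in> {(4, 4), (12, 12)} \<longrightarrow> 4 dvd r"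
        "(p mod 16, q mod 16) \<in> {(4, 12), (8, 8), (12, 4)} \<longrightarrow> 2 dvd r"
    using cases by argo
  then show ?thesis
  proof cases
    case odd_odd
    then show ?thesis unfolding N by (rule infinite_quadruples_odd_odd)
  next
    case odd_even
    then show ?thesis unfolding N by (rule infinite_quadruples_odd_dvd_4)
  next
    case even_odd
    then show ?thesis unfolding N
      by (rule infinite_quadruples_reflect[OF infinite_quadruples_odd_dvd_4])
  next
    case even_even
    consider "16 dvd p" "8 dvd q" | "16 dvd q" "8 dvd p"
      | "\<not> (16 dvd p \<and> 8 dvd q)" "\<not> (16 dvd q \<and> 8 dvd p)" by blast
    then show ?thesis
    proof cases
      case 1
      then show ?thesis unfolding N by (rule infinite_quadruples_dvd_16_dvd_8)
    next
      case 2
      then show ?thesis unfolding N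
        by (rule infinite_quadruples_reflect[OF infinite_quadruples_dvd_16_dvd_8])
    next
      case 3
      \<comment> \<open>With \<open>k + l\<close> even, \<open>k\<close> and \<open>l\<close> are now both odd or both \<open>2\<close> modulo \<open>4\<close>, and each of these
        residue pairs comes with a condition on \<open>r\<close>.\<close>
      obtain k l where p: "p = 4 * k" and q: "q = 4 * l" using even_even by (meson dvdE)
      have m16: "(4 * j) mod 16 = 4 * (j mod 4)" for j :: int
        using mult_mod_right[of 4 j 4] by simp
      have d8: "8 dvd 4 * j \<longleftrightarrow> 2 dvd j" and d16: "16 dvd 4 * j \<longleftrightarrow> 4 dvd j" for j :: int
        using dvd_mult_cancel_left[of 4 2 j] dvd_mult_cancel_left[of 4 4 j] by simp_all
      have eq: "k mod 4 = 1 \<and> l mod 4 = 1 \<or> k mod 4 = 3 \<and> l mod 4 = 3 \<Longrightarrow> 4 dvd r"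
        and neq: "k mod 4 = 1 \<and> l mod 4 = 3 \<or> k mod 4 = 2 \<and> l mod 4 = 2
          \<or> k mod 4 = 3 \<and> l mod 4 = 1 \<Longrightarrow> 2 dvd r"
        using even_even(3,4) unfolding p q m16 by auto
      have n3: "\<not> (4 dvd k \<and> 2 dvd l)" "\<not> (4 dvd l \<and> 2 dvd k)"
        using 3 unfolding p q d8 d16 by auto
      have "odd (k + l) \<or> (4 dvd k + l \<and> even r) \<or> 4 dvd r"
        using eq neq n3 by presburger
      moreover have "4 dvd r" if "k + l = - 2"
        using eq n3 that by presburger
      ultimately show ?thesis unfolding N p q by (rule infinite_quadruples_dvd_4_dvd_4)
    qed
  qed
qed

end
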